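(* For batch size $N$ and capacity $C$, the TETRIS algorithm has time complexity $\mathcal{O}(C\log N)$.
   Context: TETRIS algorithm (inputs: numbers $p_{i,j}\in[0,1]$ for $1\le i\le N$, $j\ge 1$; batch size $N$; capacity $C$). Let $\mathcal{B}_{i,j} = (i,j,\prod_{t=1}^{j}p_{i,t})$; these tuples are given as input. Initialize $\mathcal{D}^*=\emptyset$, an array $Z$ of size $N$ with all entries $-1$, and a max-heap, keyed by the third component, into which $\mathcal{B}_{i,1}$ is inserted for every $i\in\{1,\dots,N\}$. Repeat until $|\mathcal{D}^*| = C$: extract from the heap an entry $(i,j,\cdot)$ with the largest key, add $(i,j)$ to $\mathcal{D}^*$, set $Z[i]=j$, and insert $\mathcal{B}_{i,j+1}$ into the heap. Return $\mathcal{D}^*$. The heap is a standard binary heap, in which each insert or extract-max operation on a heap of size $m$ takes time $\mathcal{O}(\log m)$.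
   Formalization: Proved for N ≥ 2 and C ≥ 1: the repeat-loop takes O(C log N) time; the whole run, including initializing Z and the N heap insertions, takes O(C log N) when N ≤ αC for a fixed α > 0 (constant depending on α), as initialization alone takes at least N steps. *)

theory Defs
  imports Complex_Main "HOL-Library.While_Combinator"
begin

text \<open>
  Cost model: unit-cost RAM. Functions that do work return the number of time units they use next
  to their result. One unit pays for a bounded number of primitive operations: index arithmetic,
  tests, key comparisons, and reads or writes of an array cell. Lists stand for arrays, so \<open>h ! i\<close>,
  \<open>h[i := x]\<close>, appending one cell at the end and dropping the last cell are primitive.
  The entries \<open>draft p i j\<close> are input data, so reading one is primitive as well.
\<close>

type_synonym entry = "nat \<times> nat \<times> real"

definition key :: "entry \<Rightarrow> real" where
  "key e = snd (snd e)"

definition draft :: "(nat \<Rightarrow> nat \<Rightarrow> real) \<Rightarrow> nat \<Rightarrow> nat \<Rightarrow> entry" where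
  "draft p i j = (i, j, \<Prod>t = 1..j. p i t)"


text \<open>
  Array-based binary max-heap: the root is cell \<open>0\<close>, the parent of cell \<open>i > 0\<close> is
  \<open>(i - 1) div 2\<close>, and the children of cell \<open>i\<close> are \<open>2 * i + 1\<close> and \<open>2 * i + 2\<close>.
\<close>

definition swap_cells :: "'a list \<Rightarrow> nat \<Rightarrow> nat \<Rightarrow> 'a list" where
  "swap_cells h i k = h[i := h ! k, k := h ! i]"

function sift_up :: "entry list \<Rightarrow> nat \<Rightarrow> entry list \<times> nat" where
  "sift_up h i =
    (let parent = (i - 1) div 2 in
     if i = 0 \<or> key (h ! i) \<le> key (h ! parent) then (h, 1)
     else let (h', t) = sift_up (swap_cells h i parent) parent in (h', 1 + t))"
  by pat_completeness auto
termination
  by (relation "measure snd") auto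

function sift_down :: "entry list \<Rightarrow> nat \<Rightarrow> entry list \<times> nat" where
  "sift_down h i =
    (let l = 2 * i + 1; r = 2 * i + 2;
         child = (if r < length h \<and> key (h ! l) < key (h ! r) then r else l) in
     if length h \<le> l \<or> key (h ! child) \<le> key (h ! i) then (h, 1)
     else let (h', t) = sift_down (swap_cells h i child) child in (h', 1 + t))"
  by pat_completeness auto
termination
  by (relation "measure (\<lambda>(h, i). length h - i)") (auto simp: swap_cells_def)

declare sift_up.simps [simp del] sift_down.simps [simp del]

definition heap_insert :: "entry \<Rightarrow> entry list \<Rightarrow> entry list \<times> nat" where
  "heap_insert e h = (let (h', t) = sift_up (h @ [e]) (length h) in (h', 1 + t))"

definition heap_extract_max :: "entry list \<Rightarrow> entry \<times> entry list \<times> nat" where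
  "heap_extract_max h =
    (let (h', t) = sift_down (butlast (h[0 := last h])) 0 in (h ! 0, h', 1 + t))"


text \<open>
  The set \<open>\<D>*\<close> is kept together with its cardinality, so that adding a new pair and testing
  \<open>|\<D>*| = C\<close> are primitive. The array \<open>Z\<close> is indexed from \<open>1\<close>, hence \<open>Z[i]\<close> is cell \<open>i - 1\<close>.
\<close>

record tetris_state =
  selected :: "(nat \<times> nat) set"
  Z :: "int list"
  heap :: "entry list"
  clock :: nat

definition initial_heap :: "nat \<Rightarrow> (nat \<Rightarrow> nat \<Rightarrow> real) \<Rightarrow> entry list \<times> nat" where
  "initial_heap N p =
    fold (\<lambda>i (h, t). let (h', t') = heap_insert (draft p i 1) h in (h', t + t')) [1..<N + 1] ([], 0)"

text \<open>One unit for \<open>\<D>* = \<emptyset>\<close>, \<open>N\<close> units for filling \<open>Z\<close>, and the cost of \<open>N\<close> heap insertions.\<close>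

definition tetris_init :: "nat \<Rightarrow> (nat \<Rightarrow> nat \<Rightarrow> real) \<Rightarrow> tetris_state" where
  "tetris_init N p =
    (let (h, t) = initial_heap N p in
     \<lparr>selected = {}, Z = replicate N (- 1), heap = h, clock = 1 + N + t\<rparr>)"

text \<open>One unit each for the loop test, for the update of \<open>\<D>*\<close> and for the update of \<open>Z\<close>.\<close>

definition tetris_step :: "(nat \<Rightarrow> nat \<Rightarrow> real) \<Rightarrow> tetris_state \<Rightarrow> tetris_state" where
  "tetris_step p s =
    (let ((i, j, _), h1, t1) = heap_extract_max (heap s);
         (h2, t2) = heap_insert (draft p i (j + 1)) h1 in
     \<lparr>selected = insert (i, j) (selected s), Z = (Z s)[i - 1 := int j], heap = h2,
      clock = clock s + (3 + t1 + t2)\<rparr>)"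

text \<open>
  The result is the returned set, the time spent in the initialization, and the time spent in the
  main loop, including the last loop test. It is \<open>None\<close> if the loop does not terminate.
\<close>

definition tetris ::
  "nat \<Rightarrow> nat \<Rightarrow> (nat \<Rightarrow> nat \<Rightarrow> real) \<Rightarrow> ((nat \<times> nat) set \<times> nat \<times> nat) option" where
  "tetris N C p =
    (let s0 = tetris_init N p in
     map_option (\<lambda>s. (selected s, clock s0, (clock s - clock s0) + 1))
       (while_option (\<lambda>s. card (selected s) \<noteq> C) (tetris_step p) s0))"

end

theory Submission
  imports Defs "HOL-Library.Multiset"
begin

text \<open>
  During the loop the heap holds exactly one entry per row, so its size never exceeds \<open>N\<close>. A sift
  follows a path in a complete binary tree, and the 1-based cell index at least halves or doubles
  at each step, hence every heap operation costs at most \<open>2 + log 2 N\<close>. The loop makes exactly \<open>C\<close>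
  iterations because the extracted pair \<open>(i, j)\<close> is always new: the second component stored for a
  row exceeds all those selected for this row so far.
\<close>

section \<open>Binary heap operations\<close>

lemma length_swap_cells [simp]: "length (swap_cells h i k) = length h"
  by (simp add: swap_cells_def)

lemma mset_swap_cells:
  "i < length h \<Longrightarrow> k < length h \<Longrightarrow> mset (swap_cells h i k) = mset h"
  by (simp add: swap_cells_def mset_swap)

text \<open>Multisets track what the loop invariant needs: which entries are stored, and how
  many.\<close>

lemma mset_sift_up: "i < length h \<Longrightarrow> mset (fst (sift_up h i)) = mset h"
proof (induction h i rule: sift_up.induct)
  case (1 h i)
  let ?parent = "(i - 1) div 2"
  show ?case
  proof (cases "i = 0 \<or> key (h ! i) \<le> key (h ! ?parent)")
    case True
    then show ?thesis by (subst sift_up.simps) (simp add: Let_def)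
  next
    case False
    have "?parent < length h" using 1(2) by simp
    with 1(1)[OF refl False] 1(2)
    have "mset (fst (sift_up (swap_cells h i ?parent) ?parent)) = mset h"
      by (simp add: mset_swap_cells)
    with False show ?thesis
      by (subst sift_up.simps) (simp add: Let_def case_prod_beta)
  qed
qed

text \<open>The parent has at most half the 1-based index, and each level costs one unit. Powers of
  two keep the induction within the naturals; logarithms first appear in
  \<open>log2_bound\<close>.\<close>

lemma sift_up_cost: "2 ^ snd (sift_up h i) \<le> 2 * (i + 1)"
proof (induction h i rule: sift_up.induct)
  case (1 h i)
  let ?parent = "(i - 1) div 2"
  show ?case
  proof (cases "i = 0 \<or> key (h ! i) \<le> key (h ! ?parent)")
    case True
    then show ?thesis by (subst sift_up.simps) (simp add: Let_def)
  next
    case False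
    \<comment> \<open>Truncated subtraction does no harm, since \<open>i = 0\<close> is excluded in
      this case.\<close>
    then have "2 * (?parent + 1) \<le> i + 1" by auto
    with 1[OF refl False] False show ?thesis
      by (subst sift_up.simps) (simp add: Let_def case_prod_beta)
  qed
qed

lemma mset_sift_down: "mset (fst (sift_down h i)) = mset h"
proof (induction h i rule: sift_down.induct)
  case (1 h i)
  let ?l = "2 * i + 1" and ?r = "2 * i + 2"
  let ?child = "if ?r < length h \<and> key (h ! ?l) < key (h ! ?r) then ?r else ?l"
  show ?case
  proof (cases "length h \<le> ?l \<or> key (h ! ?child) \<le> key (h ! i)")
    case True
    then show ?thesis by (subst sift_down.simps) (simp only: Let_def if_True fst_conv)
  next
    case False
    then have "i < length h" "?child < length h" by auto
    with 1[OF refl refl refl False]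
    have "mset (fst (sift_down (swap_cells h i ?child) ?child)) = mset h"
      by (simp only: mset_swap_cells)
    with False show ?thesis
      by (subst sift_down.simps) (simp only: Let_def case_prod_beta if_False fst_conv)
  qed
qed

text \<open>Each move to a child at least doubles the 1-based index, which cannot exceed
  \<open>length h\<close>; the factor \<open>i + 1\<close> accounts for the levels above cell
  \<open>i\<close>.\<close>

lemma sift_down_cost:
  "i < length h \<Longrightarrow> 2 ^ snd (sift_down h i) * (i + 1) \<le> 2 * length h"
proof (induction h i rule: sift_down.induct)
  case (1 h i)
  let ?l = "2 * i + 1" and ?r = "2 * i + 2"
  let ?child = "if ?r < length h \<and> key (h ! ?l) < key (h ! ?r) then ?r else ?l"
  show ?case
  proof (cases "length h \<le> ?l \<or> key (h ! ?child) \<le> key (h ! i)")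
    case True
    with 1(2) show ?thesis
      by (subst sift_down.simps) (simp only: Let_def if_True snd_conv, simp)
  next
    case False
    let ?t = "snd (sift_down (swap_cells h i ?child) ?child)"
    from False have "?child < length h" by auto
    then have "2 ^ ?t * (?child + 1) \<le> 2 * length h"
      using 1(1)[OF refl refl refl False] by (simp only: length_swap_cells)
    moreover have "2 ^ ?t * (2 * (i + 1)) \<le> 2 ^ ?t * (?child + 1)"
      by (rule mult_left_mono) auto
    moreover have "2 ^ (1 + ?t) * (i + 1) = 2 ^ ?t * (2 * (i + 1))"
      by simp
    ultimately have "2 ^ (1 + ?t) * (i + 1) \<le> 2 * length h"
      by linarith
    with False show ?thesis
      by (subst sift_down.simps) (simp only: Let_def case_prod_beta if_False snd_conv)
  qed
qed

lemma log2_bound: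
  assumes "2 ^ t \<le> 2 * n" "n \<le> N" "0 < n"
  shows "real t \<le> 1 + log 2 (real N)"
proof -
  have "2 ^ t \<le> 2 * N" using assms by linarith
  then have "2 ^ t \<le> 2 * real N"
    by (metis of_nat_le_iff of_nat_mult of_nat_numeral of_nat_power)
  moreover have "0 < real N" using assms by simp
  ultimately have "log 2 (2 ^ t) \<le> log 2 (2 * real N)"
    by (subst log_le_cancel_iff) simp_all
  moreover have "log 2 (2 * real N) = 1 + log 2 (real N)"
    using \<open>0 < real N\<close> by (simp add: log_mult)
  ultimately show ?thesis
    by (simp add: log_nat_power)
qed

lemma mset_heap_insert: "mset (fst (heap_insert e h)) = add_mset e (mset h)"
  using mset_sift_up[of "length h" "h @ [e]"]
  by (simp add: heap_insert_def case_prod_beta)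

text \<open>The new cell has 1-based index \<open>length h + 1\<close>, at most \<open>N\<close>.
  The append adds one unit to the cost of the sift.\<close>

lemma heap_insert_cost:
  assumes "length h < N"
  shows "real (snd (heap_insert e h)) \<le> 2 + log 2 (real N)"
  using log2_bound[OF sift_up_cost[of "h @ [e]" "length h"], of N] assms
  by (simp add: heap_insert_def case_prod_beta)

lemma heap_extract_max_eq:
  assumes "h \<noteq> []"
  shows "fst (heap_extract_max h) = h ! 0"
    and "add_mset (h ! 0) (mset (fst (snd (heap_extract_max h)))) = mset h"
proof -
  show "fst (heap_extract_max h) = h ! 0"
    by (simp add: heap_extract_max_def case_prod_beta)
  have "add_mset (h ! 0) (mset (butlast (h[0 := last h]))) = mset h"
  proof (cases h)
    case (Cons x xs)
    then show ?thesis
      \<comment> \<open>In a one-cell heap the root is also the last cell, so nothing remains;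
        otherwise the last entry replaces the root.\<close>
      by (cases xs rule: rev_cases) (auto simp: butlast_append)
  qed (use assms in simp)
  then show "add_mset (h ! 0) (mset (fst (snd (heap_extract_max h)))) = mset h"
    by (simp add: heap_extract_max_def case_prod_beta mset_sift_down)
qed

text \<open>With two cells a root remains for the sift after the last cell is dropped; in the loop
  \<open>2 \<le> N\<close> guarantees this.\<close>

lemma heap_extract_max_cost:
  assumes "1 < length h" "length h \<le> N"
  shows "real (snd (snd (heap_extract_max h))) \<le> 2 + log 2 (real N)"
proof -
  have "2 ^ snd (sift_down (butlast (h[0 := last h])) 0) \<le> 2 * (length h - 1)"
    using sift_down_cost[of 0 "butlast (h[0 := last h])"] assms by simp
  from log2_bound[OF this, of N] assms show ?thesis
    by (simp add: heap_extract_max_def case_prod_beta)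
qed

section \<open>Initialization\<close>

lemma initial_heap_Suc:
  "initial_heap (Suc n) p =
    (let (h, t) = initial_heap n p; (h', t') = heap_insert (draft p (Suc n) 1) h in (h', t + t'))"
  by (simp add: initial_heap_def case_prod_beta Let_def)

lemma mset_initial_heap:
  "mset (fst (initial_heap n p)) = mset (map (\<lambda>i. draft p i 1) [1..<n + 1])"
proof (induction n)
  case 0
  then show ?case by (simp add: initial_heap_def)
next
  case (Suc n)
  then show ?case
    by (simp add: initial_heap_Suc case_prod_beta mset_heap_insert)
qed

text \<open>Every insertion is charged at the fixed bound \<open>N\<close> instead of the current
  size, which makes the induction linear in \<open>n\<close>.\<close>

lemma initial_heap_cost:
  "n \<le> N \<Longrightarrow> real (snd (initial_heap n p)) \<le> real n * (2 + log 2 (real N))"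
proof (induction n)
  case 0
  then show ?case by (simp add: initial_heap_def)
next
  case (Suc n)
  have "length (fst (initial_heap n p)) = n"
    using mset_initial_heap[of n p] by (metis add_diff_cancel_right' length_map length_upt size_mset)
  then have "real (snd (heap_insert (draft p (Suc n) 1) (fst (initial_heap n p))))
      \<le> 2 + log 2 (real N)"
    using Suc.prems by (intro heap_insert_cost) simp
  with Suc show ?case
    by (simp add: initial_heap_Suc case_prod_beta algebra_simps)
qed

section \<open>The main loop\<close>

text \<open>Distinct rows are what preserves the last conjunct: selecting \<open>(i, j)\<close>
  constrains row \<open>i\<close> only, and the sole entry of that row is the one just
  inserted.\<close>

definition tetris_inv :: "nat \<Rightarrow> tetris_state \<Rightarrow> bool" where
  "tetris_inv N s \<longleftrightarrow>
    finite (selected s) \<and> length (heap s) = N \<and> distinct (map fst (heap s)) \<and>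
    (\<forall>e \<in> set (heap s). \<forall>q \<in> selected s. fst q = fst e \<longrightarrow> snd q < fst (snd e))"

lemma tetris_inv_init: "tetris_inv N (tetris_init N p)"
proof -
  let ?h = "fst (initial_heap N p)"
  have "length ?h = N"
    using mset_initial_heap[of N p] by (metis add_diff_cancel_right' length_map length_upt size_mset)
  moreover have "mset (map fst ?h) = mset [1..<N + 1]"
    by (simp only: mset_map mset_initial_heap multiset.map_comp)
      (simp add: draft_def comp_def)
  then have "distinct (map fst ?h)"
    by (metis distinct_upt mset_eq_imp_distinct_iff)
  ultimately show ?thesis
    by (simp add: tetris_inv_def tetris_init_def case_prod_beta)
qed

lemma tetris_step_inv:
  assumes inv: "tetris_inv N s" and N: "2 \<le> N"
  shows "tetris_inv N (tetris_step p s)"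
    and "card (selected (tetris_step p s)) = Suc (card (selected s))"
    and "clock s \<le> clock (tetris_step p s)"
    and "real (clock (tetris_step p s)) \<le> real (clock s) + (7 + 2 * log 2 (real N))"
proof -
  obtain i j k where top: "heap s ! 0 = (i, j, k)" by (cases "heap s ! 0")
  define h1 where "h1 = fst (snd (heap_extract_max (heap s)))"
  define t1 where "t1 = snd (snd (heap_extract_max (heap s)))"
  define h2 where "h2 = fst (heap_insert (draft p i (j + 1)) h1)"
  define t2 where "t2 = snd (heap_insert (draft p i (j + 1)) h1)"
  have len: "length (heap s) = N" and fin: "finite (selected s)"
    and dist: "distinct (map fst (heap s))"
    and fresh: "\<And>e q. e \<in> set (heap s) \<Longrightarrow> q \<in> selected s \<Longrightarrow> fst q = fst e \<Longrightarrow> snd q < fst (snd e)"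
    using inv by (auto simp: tetris_inv_def)
  have ne: "heap s \<noteq> []" using len N by auto
  have "heap_extract_max (heap s) = ((i, j, k), h1, t1)"
    using heap_extract_max_eq(1)[OF ne] top by (simp add: h1_def t1_def prod_eq_iff)
  then have step: "tetris_step p s =
      \<lparr>selected = insert (i, j) (selected s), Z = (Z s)[i - 1 := int j], heap = h2,
       clock = clock s + (3 + t1 + t2)\<rparr>"
    by (simp add: tetris_step_def h2_def t2_def case_prod_beta)
  have m1: "mset (heap s) = mset ((i, j, k) # h1)"
    using heap_extract_max_eq(2)[OF ne] top by (simp add: h1_def)
  have m2: "mset h2 = mset (draft p i (j + 1) # h1)"
    by (simp add: h2_def mset_heap_insert)
  have set1: "set (heap s) = insert (i, j, k) (set h1)"
    using mset_eq_setD[OF m1] by simp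
  have set2: "set h2 = insert (draft p i (j + 1)) (set h1)"
    using mset_eq_setD[OF m2] by simp
  have len1: "length h1 = N - 1" using mset_eq_length[OF m1] len by simp
  have len2: "length h2 = N" using mset_eq_length[OF m2] len1 N by simp
  \<comment> \<open>The extracted entry and its replacement belong to the same row.\<close>
  have "mset (map fst (heap s)) = mset (map fst h2)"
    by (simp only: mset_map m1 m2) (simp add: draft_def)
  then have dist2: "distinct (map fst h2)"
    using dist mset_eq_imp_distinct_iff by blast
  have i_notin: "i \<notin> fst ` set h1"
    using dist2 mset_eq_imp_distinct_iff[of "map fst h2" "map fst (draft p i (j + 1) # h1)"] m2
    by (simp add: draft_def)
  \<comment> \<open>Otherwise the invariant, applied to the extracted entry, would give
    \<open>j < j\<close>.\<close>
  have new: "(i, j) \<notin> selected s"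
    using fresh[of "(i, j, k)" "(i, j)"] set1 by auto
  have "snd q < fst (snd e)"
    if "e \<in> set h2" "q \<in> insert (i, j) (selected s)" "fst q = fst e" for e q
  proof (cases "e \<in> set h1")
    case True
    \<comment> \<open>The row of \<open>e\<close> differs from \<open>i\<close>, so \<open>q\<close>
      cannot be the newly selected pair.\<close>
    with that i_notin have "q \<in> selected s" by force
    with fresh[of e q] True that set1 show ?thesis by simp
  next
    case False
    with that set2 have e: "e = draft p i (j + 1)" by simp
    with that(3) have q: "fst q = i" by (simp add: draft_def)
    \<comment> \<open>In row \<open>i\<close>, earlier selections lie below \<open>j\<close> by the
      invariant, and the new one is \<open>j\<close> itself; all are below
      \<open>j + 1\<close>.\<close>
    show ?thesis
    proof (cases "q \<in> selected s")
      case True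
      with fresh[of "(i, j, k)" q] set1 q e show ?thesis by (simp add: draft_def)
    next
      case False
      with that(2) e show ?thesis by (auto simp: draft_def)
    qed
  qed
  then show "tetris_inv N (tetris_step p s)"
    using fin len2 dist2 by (auto simp: tetris_inv_def step)
  show "card (selected (tetris_step p s)) = Suc (card (selected s))"
    using new fin by (simp add: step)
  show "clock s \<le> clock (tetris_step p s)" by (simp add: step)
  have "real t1 \<le> 2 + log 2 (real N)"
    unfolding t1_def using len N by (intro heap_extract_max_cost) auto
  moreover have "real t2 \<le> 2 + log 2 (real N)"
    unfolding t2_def using len1 N by (intro heap_insert_cost) auto
  \<comment> \<open>The constant is \<open>7 = 3 + 2 + 2\<close>: the units of the step itself and
    the fixed part of each heap operation.\<close>
  ultimately show "real (clock (tetris_step p s)) \<le> real (clock s) + (7 + 2 * log 2 (real N))"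
    by (simp add: step)
qed

text \<open>Induction on the number \<open>k\<close> of pairs still to be selected also yields
  termination. Monotonicity of the clock is recorded because \<open>tetris\<close> subtracts clock
  values in the naturals.\<close>

lemma tetris_loop:
  assumes "tetris_inv N s" "2 \<le> N" "card (selected s) + k = C"
  shows "\<exists>s'. while_option (\<lambda>s. card (selected s) \<noteq> C) (tetris_step p) s = Some s' \<and>
    clock s \<le> clock s' \<and>
    real (clock s') \<le> real (clock s) + real k * (7 + 2 * log 2 (real N))"
  using assms
proof (induction k arbitrary: s)
  case 0
  then show ?case by (subst while_option_unfold) simp
next
  case (Suc k)
  note step = tetris_step_inv[OF Suc.prems(1,2), of p]
  have "card (selected (tetris_step p s)) + k = C"
    using step(2) Suc.prems(3) by simp
  from Suc.IH[OF step(1) Suc.prems(2) this] obtain s' where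
    "while_option (\<lambda>s. card (selected s) \<noteq> C) (tetris_step p) (tetris_step p s) = Some s'"
    "clock (tetris_step p s) \<le> clock s'"
    "real (clock s') \<le> real (clock (tetris_step p s)) + real k * (7 + 2 * log 2 (real N))"
    by blast
  with step(3,4) Suc.prems(3) show ?case
    by (subst while_option_unfold) (auto simp: algebra_simps)
qed

text \<open>The leading units pay for the empty result set and for the last loop test; the
  \<open>3\<close> is one cell of \<open>Z\<close> plus the fixed part of an insertion.\<close>

lemma tetris_cost:
  assumes "2 \<le> N"
  shows "\<exists>D t_init t_loop. tetris N C p = Some (D, t_init, t_loop) \<and>
    real t_init \<le> 1 + real N * (3 + log 2 (real N)) \<and>
    real t_loop \<le> 1 + real C * (7 + 2 * log 2 (real N))"
proof -
  let ?s = "tetris_init N p"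
  have "card (selected ?s) + C = C"
    by (simp add: tetris_init_def case_prod_beta)
  from tetris_loop[OF tetris_inv_init assms this, of p] obtain s' where
    s': "while_option (\<lambda>s. card (selected s) \<noteq> C) (tetris_step p) ?s = Some s'"
      "clock ?s \<le> clock s'"
      "real (clock s') \<le> real (clock ?s) + real C * (7 + 2 * log 2 (real N))"
    by blast
  have "real (clock ?s) \<le> 1 + real N * (3 + log 2 (real N))"
    using initial_heap_cost[of N N p]
    by (simp add: tetris_init_def case_prod_beta algebra_simps)
  with s' show ?thesis
    by (auto simp: tetris_def Let_def of_nat_diff)
qed

text \<open>Initialization alone takes more than \<open>N\<close> units, so the total can be
  \<open>O(C log N)\<close> only when \<open>N\<close> is \<open>O(C)\<close>; the loop obeys the
  bound for every \<open>C \<ge> 1\<close>. The constant \<open>K\<close> depends on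
  \<open>\<alpha>\<close> alone.\<close>

theorem lemma1:
  fixes \<alpha> :: real
  assumes "\<alpha> > 0"
  shows "\<exists>K > 0. \<forall>N \<ge> 2. \<forall>C \<ge> 1. \<forall>p.
    (\<forall>i \<in> {1..N}. \<forall>j \<ge> 1. p i j \<in> {0..1}) \<longrightarrow>
    (\<exists>D t_init t_loop. tetris N C p = Some (D, t_init, t_loop) \<and>
       real t_loop \<le> K * (real C * log 2 (real N)) \<and>
       (real N \<le> \<alpha> * real C \<longrightarrow> real (t_init + t_loop) \<le> K * (real C * log 2 (real N))))"
proof (intro exI[of _ "11 + 4 * \<alpha>"] conjI allI impI)
  \<comment> \<open>In units of \<open>real C * log 2 (real N)\<close>, the loop needs
    \<open>1 + 7 + 2 = 10\<close> and the initialization \<open>1 + 4 * \<alpha>\<close>.\<close>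
  show "11 + 4 * \<alpha> > 0" using assms by simp
next
  fix N C :: nat and p :: "nat \<Rightarrow> nat \<Rightarrow> real"
  assume N: "2 \<le> N" and C: "1 \<le> C"
  define L where "L = log 2 (real N)"
  \<comment> \<open>This lets the lower-order terms \<open>1\<close> and \<open>real C\<close> be
    absorbed into \<open>real C * L\<close>.\<close>
  have L: "1 \<le> L" using N by (simp add: L_def le_log_iff)
  then have CL: "real C \<le> real C * L" "1 \<le> real C * L"
    using C mult_mono[of 1 "real C" 1 L] by auto
  obtain D t_init t_loop where t: "tetris N C p = Some (D, t_init, t_loop)"
    "real t_init \<le> 1 + real N * (3 + L)" "real t_loop \<le> 1 + real C * (7 + 2 * L)"
    using tetris_cost[OF N, of C p] unfolding L_def by blast
  have loop: "real t_loop \<le> 10 * (real C * L)"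
    using t(3) CL by (simp add: algebra_simps)
  have "0 \<le> (1 + 4 * \<alpha>) * (real C * L)" using assms L by simp
  with loop have "real t_loop \<le> (11 + 4 * \<alpha>) * (real C * L)"
    by (simp add: algebra_simps)
  moreover have "real (t_init + t_loop) \<le> (11 + 4 * \<alpha>) * (real C * L)"
    if "real N \<le> \<alpha> * real C"
  proof -
    \<comment> \<open>Here \<open>3 + L \<le> 4 * L\<close>, because
      \<open>1 \<le> L\<close>.\<close>
    have "real N * (3 + L) \<le> (\<alpha> * real C) * (4 * L)"
      using that L assms by (intro mult_mono) auto
    with t(2) have "real t_init \<le> real C * L + 4 * \<alpha> * (real C * L)"
      using CL by (simp add: mult_ac)
    with loop show ?thesis
      by (simp add: algebra_simps)
  qed
  ultimately show "\<exists>D t_init t_loop. tetris N C p = Some (D, t_init, t_loop) \<and>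
      real t_loop \<le> (11 + 4 * \<alpha>) * (real C * log 2 (real N)) \<and>
      (real N \<le> \<alpha> * real C \<longrightarrow>
        real (t_init + t_loop) \<le> (11 + 4 * \<alpha>) * (real C * log 2 (real N)))"
    using t(1) unfolding L_def by blast
qed

end
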